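(* Let $G=(V,E)$ be a finite connected loopless multigraph with $n=|V|$ vertices, site energies $x_v>0$ and edge energies $y_e>0$. Let $\widehat G$ be the augmented graph of $G$ with cut energies $\widehat X_A$. Then $$\int_{\mathbb R^{V}}\exp\Big[-\sum_{v\in V}x_v|t_v|-\sum_{e=uv\in E}y_e|t_u-t_v|\Big]\prod_{v\in V}\mathrm dt_v=\sum_{\sigma}\prod_{k=1}^n\frac1{\widehat X_{A_k^\sigma}},$$ where $\sigma=(\sigma_0,\sigma_1,\ldots,\sigma_n)$ runs over all $(n+1)!$ orderings of the vertex set $V(\widehat G)=V\sqcup\{0\}$ and $A_k^\sigma=\{\sigma_0,\ldots,\sigma_{k-1}\}$.
   Context: Loopless means no self-loops; cycles and parallel edges are allowed. The augmented graph $\widehat G$ is obtained from $G$ by adding one new vertex $0$ joined by one edge to every $v\in V$; its edges have weights $w_{0v}=x_v$ for $v\in V$ and $w_e=y_e$ for $e\in E$. For a nonempty proper subset $A\subsetneq V\sqcup\{0\}$, the cut energy $\widehat X_A$ is the sum of $w_e$ over all edges $e$ of $\widehat G$ having exactly one endpoint in $A$. *)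

theory Defs
  imports
    "HOL-Analysis.Analysis"
    "HOL-Combinatorics.Multiset_Permutations"
    "HOL-Library.Uprod"
begin

record ('v, 'e) multigraph =
  verts :: "'v set"
  edges :: "'e set"
  ends :: "'e \<Rightarrow> 'v uprod"

definition finite_multigraph :: "('v, 'e) multigraph \<Rightarrow> bool" where
  "finite_multigraph G \<longleftrightarrow>
     finite (verts G) \<and> finite (edges G) \<and> (\<forall>e\<in>edges G. set_uprod (ends G e) \<subseteq> verts G)"

definition loopless :: "('v, 'e) multigraph \<Rightarrow> bool" where
  "loopless G \<longleftrightarrow> (\<forall>e\<in>edges G. proper_uprod (ends G e))"

definition adjacency :: "('v, 'e) multigraph \<Rightarrow> ('v \<times> 'v) set" where
  "adjacency G = {(u, v). \<exists>e\<in>edges G. ends G e = Upair u v}"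

definition connected_multigraph :: "('v, 'e) multigraph \<Rightarrow> bool" where
  "connected_multigraph G \<longleftrightarrow>
     verts G \<noteq> {} \<and> (\<forall>u\<in>verts G. \<forall>v\<in>verts G. (u, v) \<in> (adjacency G)\<^sup>*)"

text \<open>The new vertex \<open>0\<close> is \<^const>\<open>None\<close>. The new edge from it to \<open>v\<close> is \<open>Inl v\<close>, and an old edge
  \<open>e\<close> becomes \<open>Inr e\<close>.\<close>

definition augment :: "('v, 'e) multigraph \<Rightarrow> ('v option, 'v + 'e) multigraph" where
  "augment G =
     \<lparr>verts = insert None (Some ` verts G),
      edges = Inl ` verts G \<union> Inr ` edges G,
      ends = case_sum (\<lambda>v. Upair None (Some v)) (\<lambda>e. map_uprod Some (ends G e))\<rparr>"

definition augment_weight :: "('v \<Rightarrow> real) \<Rightarrow> ('e \<Rightarrow> real) \<Rightarrow> 'v + 'e \<Rightarrow> real" where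
  "augment_weight x y = case_sum x y"

definition cut_edges :: "('v, 'e) multigraph \<Rightarrow> 'v set \<Rightarrow> 'e set" where
  "cut_edges G A =
     {e \<in> edges G. \<exists>u v. ends G e = Upair u v \<and> u \<in> A \<and> v \<notin> A}"

definition cut_energy ::
    "('v, 'e) multigraph \<Rightarrow> ('v \<Rightarrow> real) \<Rightarrow> ('e \<Rightarrow> real) \<Rightarrow> 'v option set \<Rightarrow> real" where
  "cut_energy G x y A = (\<Sum>e\<in>cut_edges (augment G) A. augment_weight x y e)"

lift_definition abs_diff_commute :: "('v \<Rightarrow> real) \<Rightarrow> ('v, real) commute"
  is "\<lambda>t u v. \<bar>t u - t v\<bar>"
  by (simp add: abs_minus_commute)

definition abs_diff :: "('v \<Rightarrow> real) \<Rightarrow> 'v uprod \<Rightarrow> real" where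
  "abs_diff t = case_uprod (abs_diff_commute t)"

lemma abs_diff_Upair [simp]: "abs_diff t (Upair u v) = \<bar>t u - t v\<bar>"
  by (simp add: abs_diff_def abs_diff_commute.rep_eq)

end

theory Submission
  imports Defs
begin

(* The value vector t, extended by 0 at the new vertex, is almost everywhere injective on the
  augmented vertex set, so exactly one ordering lists the vertices by decreasing value. Along that
  ordering each |t_u - t_v| telescopes into consecutive gaps, and collecting the coefficient of the
  k-th gap turns the exponent into a sum of cut energies times gaps. On the sector of a fixed
  ordering the integrand is therefore a product of one-dimensional exponentials in consecutive
  gaps. At least one of the two extreme vertices of the ordering differs from the new vertex; it
  occurs in one factor only, so integrating it out yields one reciprocal cut energy, and induction
  on the length of the ordering gives the product. *)

section \<open>Values extended by zero to the new vertex\<close>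

text \<open>Pinning the new vertex at 0 turns each \<open>|t v|\<close> into a difference across a
  new edge, so site and edge energies take one form.\<close>

definition rooted :: "('v \<Rightarrow> real) \<Rightarrow> 'v option \<Rightarrow> real" where
  "rooted t = case_option 0 t"

lemma rooted_simps [simp]: "rooted t None = 0" "rooted t (Some v) = t v"
  by (simp_all add: rooted_def)

lemma rooted_fun_upd: "rooted (t(v := a)) i = (if i = Some v then a else rooted t i)"
  by (cases i) auto

lemma measurable_rooted:
  assumes "i \<in> insert None (Some ` V)"
  shows "(\<lambda>t. rooted t i) \<in> borel_measurable (PiM V (\<lambda>_. lborel))"
proof (cases i)
  case (Some v)
  then have v: "v \<in> V" using assms by auto
  have "(\<lambda>t. t v) \<in> measurable (PiM V (\<lambda>_. lborel)) (lborel :: real measure)"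
    using v by (rule measurable_component_singleton)
  then show ?thesis using Some by simp
qed simp

section \<open>Exponential integrals over a single gap\<close>

text \<open>The value 0 for \<open>a < b\<close> builds the indicator of the sector into the factor.
  Values in \<open>ennreal\<close> allow iterated integration and summation before integrability is
  known.\<close>

definition gap_factor :: "real \<Rightarrow> real \<Rightarrow> real \<Rightarrow> ennreal" where
  "gap_factor c a b = (if b \<le> a then ennreal (exp (- (c * (a - b)))) else 0)"

lemma measurable_gap_factor [measurable]:
  assumes [measurable]: "f \<in> borel_measurable M" "g \<in> borel_measurable M"
  shows "(\<lambda>z. gap_factor c (f z) (g z)) \<in> borel_measurable M"
  unfolding gap_factor_def by measurable

lemma nn_integral_gap_factor_0:
  assumes "c > 0"
  shows "(\<integral>\<^sup>+ s. gap_factor c s 0 \<partial>lborel) = ennreal (1 / c)"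
proof -
  have lim: "((\<lambda>s. - exp (- (c * s)) / c) \<longlongrightarrow> 0) at_top"
  proof -
    have "filterlim (\<lambda>s. c * s) at_top at_top"
      using assms by (intro filterlim_tendsto_pos_mult_at_top[OF tendsto_const]) (auto intro: filterlim_ident)
    then have "((\<lambda>s. exp (- (c * s))) \<longlongrightarrow> 0) at_top"
      by (intro filterlim_compose[OF exp_at_bot]) (simp add: filterlim_uminus_at_top)
    then have "((\<lambda>s. - exp (- (c * s)) / c) \<longlongrightarrow> - 0 / c) at_top"
      using assms by (intro tendsto_intros) auto
    then show ?thesis by simp
  qed
  have "(\<integral>\<^sup>+ s. ennreal (exp (- (c * s))) * indicator {0..} s \<partial>lborel) = ennreal (0 - (- exp (- (c * 0)) / c))"
    using assms lim
    by (intro nn_integral_FTC_atLeast) (auto intro!: derivative_eq_intros)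
  moreover have "gap_factor c s 0 = ennreal (exp (- (c * s))) * indicator {0..} s" for s
    by (simp add: gap_factor_def)
  ultimately show ?thesis
    by simp
qed

lemma nn_integral_gap_factor_left:
  assumes "c > 0"
  shows "(\<integral>\<^sup>+ a. gap_factor c a b \<partial>lborel) = ennreal (1 / c)"
proof -
  have "(\<integral>\<^sup>+ a. gap_factor c a b \<partial>lborel) = (\<integral>\<^sup>+ s. gap_factor c (b + 1 * s) b \<partial>lborel)"
    by (subst nn_integral_real_affine[where t = b and c = 1]) auto
  moreover have "gap_factor c (b + 1 * s) b = gap_factor c s 0" for s
    by (simp add: gap_factor_def)
  ultimately show ?thesis
    using nn_integral_gap_factor_0[OF assms] by simp
qed

lemma nn_integral_gap_factor_right:
  assumes "c > 0"
  shows "(\<integral>\<^sup>+ b. gap_factor c a b \<partial>lborel) = ennreal (1 / c)"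
proof -
  \<comment> \<open>Here the upper value is fixed, so the substitution is the reflection
    \<open>b = a - s\<close>, whose Jacobian has absolute value 1.\<close>
  have "(\<integral>\<^sup>+ b. gap_factor c a b \<partial>lborel) = (\<integral>\<^sup>+ s. gap_factor c a (a + (- 1) * s) \<partial>lborel)"
    by (subst nn_integral_real_affine[where t = a and c = "- 1"]) auto
  moreover have "gap_factor c a (a + (- 1) * s) = gap_factor c s 0" for s
    by (simp add: gap_factor_def)
  ultimately show ?thesis
    using nn_integral_gap_factor_0[OF assms] by simp
qed

section \<open>Products of gap factors along an ordering\<close>

text \<open>Coefficients belong to positions, not to vertices: removing the head shifts them by
  \<open>Suc\<close>, removing the last entry leaves them in place.\<close>

definition gap_prod :: "(nat \<Rightarrow> real) \<Rightarrow> 'i list \<Rightarrow> ('i \<Rightarrow> real) \<Rightarrow> ennreal" where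
  "gap_prod c l T = (\<Prod>k<length l - 1. gap_factor (c k) (T (l ! k)) (T (l ! Suc k)))"

lemma gap_prod_cong: "(\<And>i. i \<in> set l \<Longrightarrow> T i = T' i) \<Longrightarrow> gap_prod c l T = gap_prod c l T'"
  unfolding gap_prod_def by (intro prod.cong) auto

lemma gap_prod_Cons:
  assumes "l \<noteq> []"
  shows "gap_prod c (i # l) T = gap_factor (c 0) (T i) (T (hd l)) * gap_prod (c \<circ> Suc) l T"
  using assms by (cases l) (simp_all add: gap_prod_def prod.lessThan_Suc_shift del: prod.lessThan_Suc)

lemma gap_prod_snoc:
  assumes "l \<noteq> []"
  shows "gap_prod c (l @ [i]) T =
    gap_factor (c (length l - 1)) (T (last l)) (T i) * gap_prod c l T"
proof -
  obtain m where m: "length l = Suc m"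
    using assms by (cases l) auto
  have "gap_prod c (l @ [i]) T = (\<Prod>k<Suc m. gap_factor (c k) (T ((l @ [i]) ! k)) (T ((l @ [i]) ! Suc k)))"
    by (simp add: gap_prod_def m)
  also have "\<dots> = gap_factor (c m) (T (l ! m)) (T i) *
      (\<Prod>k<m. gap_factor (c k) (T ((l @ [i]) ! k)) (T ((l @ [i]) ! Suc k)))"
    by (simp add: nth_append m mult.commute)
  also have "(\<Prod>k<m. gap_factor (c k) (T ((l @ [i]) ! k)) (T ((l @ [i]) ! Suc k))) = gap_prod c l T"
    unfolding gap_prod_def by (intro prod.cong) (auto simp: nth_append m)
  finally show ?thesis
    using assms by (simp add: last_conv_nth m)
qed

lemma measurable_gap_prod:
  assumes "set l \<subseteq> insert None (Some ` V)"
  shows "(\<lambda>t. gap_prod c l (rooted t)) \<in> borel_measurable (PiM V (\<lambda>_. lborel))"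
  unfolding gap_prod_def
proof (rule borel_measurable_prod_ennreal)
  fix k assume "k \<in> {..<length l - 1}"
  then have "l ! k \<in> set l" "l ! Suc k \<in> set l" by auto
  then show "(\<lambda>t. gap_factor (c k) (rooted t (l ! k)) (rooted t (l ! Suc k)))
      \<in> borel_measurable (PiM V (\<lambda>_. lborel))"
    using assms by (intro measurable_gap_factor measurable_rooted) auto
qed

section \<open>The integral over one sector\<close>

lemma subset_insert_None: "A \<subseteq> insert None (Some ` {v. Some v \<in> A})"
proof
  fix i assume "i \<in> A"
  then show "i \<in> insert None (Some ` {v. Some v \<in> A})" by (cases i) auto
qed

interpretation lborel_product: product_sigma_finite "\<lambda>_. lborel :: real measure"
  by standard

text \<open>The coefficients are arbitrary positive numbers because a shortened list no longer
  orders the whole vertex set. Keeping \<open>None\<close> in the list anchors the values at 0;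
  without an anchor, invariance under translation would make the integral infinite.\<close>

lemma nn_integral_gap_prod:
  fixes l :: "'v option list"
  assumes "distinct l" "None \<in> set l" "\<And>k. k < length l - 1 \<Longrightarrow> c k > 0"
  shows "(\<integral>\<^sup>+ t. gap_prod c l (rooted t) \<partial>PiM {v. Some v \<in> set l} (\<lambda>_. lborel)) =
    (\<Prod>k<length l - 1. ennreal (1 / c k))"
  using assms
proof (induction "length l" arbitrary: l c rule: less_induct)
  case less
  \<comment> \<open>The two ends of a longer list are distinct, so they cannot both be
    \<open>None\<close>; the last entry is peeled off only when the first is
    \<open>None\<close>.\<close>
  consider "l = [None]" | v l' where "l = Some v # l'" "l' \<noteq> []"
    | v l' where "l = l' @ [Some v]" "l' \<noteq> []"
  proof -
    obtain i l1 where l: "l = i # l1"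
      using less.prems(2) by (cases l) auto
    show thesis
    proof (cases l1 rule: rev_cases)
      case Nil
      then show thesis using l less.prems(2) that(1) by auto
    next
      case (snoc l2 j)
      show thesis
      proof (cases i)
        case None
        then obtain w where "j = Some w"
          using l snoc less.prems(1) by (cases j) auto
        then show thesis using that(3)[of "i # l2"] l snoc by auto
      next
        case (Some w)
        then show thesis using that(2)[of w l1] l snoc by auto
      qed
    qed
  qed
  then show ?case
  proof cases
    case 1
    then show ?thesis
      by (simp add: gap_prod_def PiM_empty)
  next
    case (2 v l')
    let ?V = "{v. Some v \<in> set l'}"
    have V: "{v. Some v \<in> set l} = insert v ?V" and v: "v \<notin> ?V" and None: "None \<in> set l'"
      using 2 less.prems by auto
    have fin: "finite ?V"
      using finite_vimageI[of "set l'" Some] by (simp add: vimage_def)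
    have hd: "hd l' \<noteq> Some v" using 2 less.prems(1) hd_in_set by fastforce
    have len: "length l - 1 = Suc (length l' - 1)" using 2 by (cases l') auto
    have c0: "c 0 > 0" using less.prems(3) len by simp
    \<comment> \<open>The coordinate \<open>v\<close> enters the first factor alone, since
      \<open>Some v\<close> does not occur in \<open>l'\<close>.\<close>
    have upd: "gap_prod c l (rooted (t(v := a))) =
        gap_factor (c 0) a (rooted t (hd l')) * gap_prod (c \<circ> Suc) l' (rooted t)" for t a
    proof -
      have "gap_prod (c \<circ> Suc) l' (rooted (t(v := a))) = gap_prod (c \<circ> Suc) l' (rooted t)"
        using v by (intro gap_prod_cong) (auto simp: rooted_fun_upd)
      then show ?thesis
        using 2 hd by (simp add: gap_prod_Cons rooted_fun_upd)
    qed
    have "(\<integral>\<^sup>+ t. gap_prod c l (rooted t) \<partial>PiM (insert v ?V) (\<lambda>_. lborel)) =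
        (\<integral>\<^sup>+ t. (\<integral>\<^sup>+ a. gap_prod c l (rooted (t(v := a))) \<partial>lborel) \<partial>PiM ?V (\<lambda>_. lborel))"
    proof (rule lborel_product.product_nn_integral_insert[OF fin v], rule measurable_gap_prod)
      show "set l \<subseteq> insert None (Some ` insert v ?V)"
        using subset_insert_None[of "set l"] unfolding V .
    qed
    \<comment> \<open>The inner integral is \<open>1 / c 0\<close> whatever the neighbouring value
      is, so it leaves the outer integral as a constant.\<close>
    also have "\<dots> = (\<integral>\<^sup>+ t. ennreal (1 / c 0) * gap_prod (c \<circ> Suc) l' (rooted t) \<partial>PiM ?V (\<lambda>_. lborel))"
      unfolding upd using c0
      by (subst nn_integral_multc) (auto simp: nn_integral_gap_factor_left)
    also have "\<dots> = ennreal (1 / c 0) * (\<integral>\<^sup>+ t. gap_prod (c \<circ> Suc) l' (rooted t) \<partial>PiM ?V (\<lambda>_. lborel))"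
    proof (rule nn_integral_cmult, rule measurable_gap_prod)
      show "set l' \<subseteq> insert None (Some ` ?V)"
        by (rule subset_insert_None)
    qed
    also have "(\<integral>\<^sup>+ t. gap_prod (c \<circ> Suc) l' (rooted t) \<partial>PiM ?V (\<lambda>_. lborel)) =
        (\<Prod>k<length l' - 1. ennreal (1 / (c \<circ> Suc) k))"
      using 2 less.prems None len by (intro less.hyps) auto
    finally show ?thesis
      unfolding V len by (simp add: prod.lessThan_Suc_shift del: prod.lessThan_Suc)
  next
    case (3 v l')
    let ?V = "{v. Some v \<in> set l'}"
    have V: "{v. Some v \<in> set l} = insert v ?V" and v: "v \<notin> ?V" and None: "None \<in> set l'"
      using 3 less.prems by auto
    have fin: "finite ?V"
      using finite_vimageI[of "set l'" Some] by (simp add: vimage_def)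
    have last: "last l' \<noteq> Some v" using 3 less.prems(1) last_in_set by fastforce
    have len: "length l - 1 = Suc (length l' - 1)" using 3 by (cases l') auto
    \<comment> \<open>Mirror case: the removed factor is the final one, and the remaining
      coefficients keep their indices.\<close>
    let ?c = "c (length l' - 1)"
    have c0: "?c > 0" using less.prems(3) len by simp
    have upd: "gap_prod c l (rooted (t(v := a))) =
        gap_factor ?c (rooted t (last l')) a * gap_prod c l' (rooted t)" for t a
    proof -
      have "gap_prod c l' (rooted (t(v := a))) = gap_prod c l' (rooted t)"
        using v by (intro gap_prod_cong) (auto simp: rooted_fun_upd)
      then show ?thesis
        using 3 last by (simp add: gap_prod_snoc rooted_fun_upd)
    qed
    have "(\<integral>\<^sup>+ t. gap_prod c l (rooted t) \<partial>PiM (insert v ?V) (\<lambda>_. lborel)) =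
        (\<integral>\<^sup>+ t. (\<integral>\<^sup>+ a. gap_prod c l (rooted (t(v := a))) \<partial>lborel) \<partial>PiM ?V (\<lambda>_. lborel))"
    proof (rule lborel_product.product_nn_integral_insert[OF fin v], rule measurable_gap_prod)
      show "set l \<subseteq> insert None (Some ` insert v ?V)"
        using subset_insert_None[of "set l"] unfolding V .
    qed
    also have "\<dots> = (\<integral>\<^sup>+ t. ennreal (1 / ?c) * gap_prod c l' (rooted t) \<partial>PiM ?V (\<lambda>_. lborel))"
      unfolding upd using c0
      by (subst nn_integral_multc) (auto simp: nn_integral_gap_factor_right)
    also have "\<dots> = ennreal (1 / ?c) * (\<integral>\<^sup>+ t. gap_prod c l' (rooted t) \<partial>PiM ?V (\<lambda>_. lborel))"
    proof (rule nn_integral_cmult, rule measurable_gap_prod)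
      show "set l' \<subseteq> insert None (Some ` ?V)"
        by (rule subset_insert_None)
    qed
    also have "(\<integral>\<^sup>+ t. gap_prod c l' (rooted t) \<partial>PiM ?V (\<lambda>_. lborel)) =
        (\<Prod>k<length l' - 1. ennreal (1 / c k))"
      using 3 less.prems None len by (intro less.hyps) auto
    finally show ?thesis
      unfolding V len by (simp add: mult.commute)
  qed
qed

section \<open>Ties between values form a null set\<close>

text \<open>With the other coordinates fixed, \<open>rooted t j\<close> is constant in the
  coordinate \<open>v\<close>, so a tie confines \<open>t v\<close> to a single point.\<close>

lemma AE_rooted_neq:
  assumes "finite V" "v \<in> V" "j \<in> insert None (Some ` V)" "j \<noteq> Some v"
  shows "AE t in PiM V (\<lambda>_. lborel). t v \<noteq> rooted t j"
proof -
  let ?M = "PiM V (\<lambda>_. lborel :: real measure)"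
  let ?N = "\<lambda>t. indicator {0} (t v - rooted t j) :: ennreal"
  define W where "W = V - {v}"
  have W: "finite W" "v \<notin> W" "insert v W = V"
    using assms by (auto simp: W_def)
  have [measurable]: "(\<lambda>t. t v) \<in> borel_measurable ?M" "(\<lambda>t. rooted t j) \<in> borel_measurable ?M"
    using measurable_rooted[of "Some v" V] measurable_rooted[of j V] assms by auto
  have meas: "?N \<in> borel_measurable ?M"
    by measurable
  have "(\<integral>\<^sup>+ t. ?N t \<partial>?M) =
      (\<integral>\<^sup>+ t. (\<integral>\<^sup>+ a. ?N (t(v := a)) \<partial>lborel) \<partial>PiM W (\<lambda>_. lborel))"
    using lborel_product.product_nn_integral_insert[OF W(1,2), of ?N] meas W(3) by simp
  also have "\<dots> = (\<integral>\<^sup>+ t. (\<integral>\<^sup>+ a. indicator {rooted t j} a \<partial>lborel) \<partial>PiM W (\<lambda>_. lborel))"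
    using assms(4) by (intro nn_integral_cong) (auto simp: rooted_fun_upd indicator_def)
  also have "\<dots> = 0"
    by simp
  finally have "AE t in ?M. ?N t = 0"
    using meas by (subst (asm) nn_integral_0_iff_AE)
  then show ?thesis
    by eventually_elim (auto simp: indicator_def split: if_splits)
qed

lemma AE_inj_on_rooted:
  assumes "finite V"
  shows "AE t in PiM V (\<lambda>_. lborel). inj_on (rooted t) (insert None (Some ` V))"
proof -
  have "AE t in PiM V (\<lambda>_. lborel). \<forall>v\<in>V. \<forall>j\<in>insert None (Some ` V) - {Some v}. t v \<noteq> rooted t j"
    using assms AE_rooted_neq[OF assms] by (intro AE_finite_allI) auto
  then show ?thesis
  proof eventually_elim
    case (elim t)
    show ?case
    proof (rule inj_onI, rule ccontr)
      fix i j assume ij: "i \<in> insert None (Some ` V)" "j \<in> insert None (Some ` V)"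
        "rooted t i = rooted t j" "i \<noteq> j"
      \<comment> \<open>Two distinct augmented vertices include an old one, to which the almost sure
        inequality applies.\<close>
      then consider v where "i = Some v" "v \<in> V" | v where "j = Some v" "v \<in> V"
        by auto
      then show False
      proof cases
        case 1
        then show False using elim ij by force
      next
        case 2
        then show False using elim ij by (metis DiffI rooted_simps(2) singletonD)
      qed
    qed
  qed
qed

section \<open>Telescoping the energy along an ordering\<close>

text \<open>An edge with ends at positions \<open>a \<le> b\<close> crosses the cut after position
  \<open>k\<close> exactly when \<open>a \<le> k < b\<close>, and these are the gaps that add up to
  its difference of values. Exchanging the sums over edges and gaps collects the cut
  weights.\<close>

lemma energy_eq_sum_cuts:
  assumes "finite_multigraph H" "distinct \<sigma>" "set \<sigma> = verts H" "sorted_wrt (\<ge>) (map T \<sigma>)"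
  shows "(\<Sum>e\<in>edges H. w e * abs_diff T (ends H e)) =
    (\<Sum>k<length \<sigma> - 1. (\<Sum>e\<in>cut_edges H (set (take (Suc k) \<sigma>)). w e) * (T (\<sigma> ! k) - T (\<sigma> ! Suc k)))"
proof -
  let ?C = "\<lambda>k. cut_edges H (set (take (Suc k) \<sigma>))"
  let ?d = "\<lambda>k. T (\<sigma> ! k) - T (\<sigma> ! Suc k)"
  have fin: "finite (edges H)"
    using assms(1) by (simp add: finite_multigraph_def)
  have edge: "abs_diff T (ends H e) = (\<Sum>k<length \<sigma> - 1. if e \<in> ?C k then ?d k else 0)"
    if e: "e \<in> edges H" for e
  proof -
    \<comment> \<open>Ends are unordered, so the earlier position may be called \<open>a\<close>. A
      loop has \<open>a = b\<close> and contributes nothing on either side.\<close>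
    obtain a b where ab: "ends H e = Upair (\<sigma> ! a) (\<sigma> ! b)" "a \<le> b" "b < length \<sigma>"
    proof -
      obtain u v where uv: "ends H e = Upair u v" by (cases "ends H e")
      then have "u \<in> set \<sigma>" "v \<in> set \<sigma>"
        using assms(1,3) e by (force simp: finite_multigraph_def)+
      then obtain i j where "u = \<sigma> ! i" "i < length \<sigma>" "v = \<sigma> ! j" "j < length \<sigma>"
        by (metis in_set_conv_nth)
      then show thesis
        using that[of i j] that[of j i] uv by (cases "i \<le> j") auto
    qed
    have take: "\<sigma> ! i \<in> set (take (Suc k) \<sigma>) \<longleftrightarrow> i \<le> k" if "i < length \<sigma>" for i k
      using that assms(2) by (auto simp: in_set_conv_nth nth_eq_iff_index_eq less_Suc_eq_le)
    have cut: "e \<in> ?C k \<longleftrightarrow> a \<le> k \<and> k < b" for k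
      using ab e take[of a k] take[of b k] by (auto simp: cut_edges_def)
    have "T (\<sigma> ! b) \<le> T (\<sigma> ! a)"
      using assms(4) ab by (cases "a = b") (auto simp: sorted_wrt_iff_nth_less)
    then have "abs_diff T (ends H e) = T (\<sigma> ! a) - T (\<sigma> ! b)"
      using ab by simp
    \<comment> \<open>The values decrease along the ordering, so the telescoping rule is applied to
      their negatives.\<close>
    also have "\<dots> = (\<Sum>k=a..<b. ?d k)"
      using sum_Suc_diff'[of a b "\<lambda>k. - T (\<sigma> ! k)"] ab by simp
    also have "\<dots> = (\<Sum>k<length \<sigma> - 1. if e \<in> ?C k then ?d k else 0)"
      unfolding cut using ab(2,3) by (intro sum.mono_neutral_cong_left) auto
    finally show ?thesis .
  qed
  have "(\<Sum>e\<in>edges H. w e * abs_diff T (ends H e)) =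
      (\<Sum>e\<in>edges H. \<Sum>k<length \<sigma> - 1. if e \<in> ?C k then w e * ?d k else 0)"
    by (intro sum.cong refl, simp only: edge sum_distrib_left) (intro sum.cong, auto)
  also have "\<dots> = (\<Sum>k<length \<sigma> - 1. \<Sum>e\<in>edges H. if e \<in> ?C k then w e * ?d k else 0)"
    by (rule sum.swap)
  also have "\<dots> = (\<Sum>k<length \<sigma> - 1. (\<Sum>e\<in>?C k. w e) * ?d k)"
  proof (intro sum.cong refl)
    fix k
    have "?C k \<subseteq> edges H" by (auto simp: cut_edges_def)
    then show "(\<Sum>e\<in>edges H. if e \<in> ?C k then w e * ?d k else 0) = (\<Sum>e\<in>?C k. w e) * ?d k"
      using fin by (simp add: sum.If_cases sum_distrib_right Int_absorb1)
  qed
  finally show ?thesis .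
qed

section \<open>Decomposing the exponential over orderings\<close>

lemma gap_prod_sorted:
  assumes "sorted_wrt (\<ge>) (map T l)"
  shows "gap_prod c l T = ennreal (exp (- (\<Sum>k<length l - 1. c k * (T (l ! k) - T (l ! Suc k)))))"
proof -
  have "gap_prod c l T = (\<Prod>k<length l - 1. ennreal (exp (- (c k * (T (l ! k) - T (l ! Suc k))))))"
    unfolding gap_prod_def
    using assms by (intro prod.cong) (auto simp: gap_factor_def sorted_wrt_iff_nth_less)
  also have "\<dots> = ennreal (\<Prod>k<length l - 1. exp (- (c k * (T (l ! k) - T (l ! Suc k)))))"
    by (simp add: prod_ennreal)
  finally show ?thesis
    by (simp add: exp_sum flip: sum_negf)
qed

text \<open>By transitivity, a failure of monotonicity already occurs at some consecutive pair, and
  the factor of that pair is 0.\<close>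

lemma gap_prod_not_sorted:
  assumes "\<not> sorted_wrt (\<ge>) (map T l)"
  shows "gap_prod c l T = 0"
proof -
  obtain k where k: "Suc k < length l" "\<not> T (l ! Suc k) \<le> T (l ! k)"
    using assms by (subst (asm) sorted_wrt_iff_nth_Suc_transp) (auto simp: transp_def)
  then have "k \<in> {..<length l - 1}" "gap_factor (c k) (T (l ! k)) (T (l ! Suc k)) = 0"
    by (auto simp: gap_factor_def)
  then show ?thesis
    unfolding gap_prod_def by (meson finite_lessThan prod_zero)
qed

lemma ex1_decreasing_permutation:
  fixes T :: "'i \<Rightarrow> real"
  assumes "finite W" "inj_on T W"
  shows "\<exists>!\<sigma>. \<sigma> \<in> permutations_of_set W \<and> sorted_wrt (\<ge>) (map T \<sigma>)"
proof (rule ex_ex1I)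
  let ?xs = "rev (sorted_list_of_set (T ` W))"
  \<comment> \<open>The ordering is read off by listing the values in decreasing order and pulling
    them back along the injective \<open>T\<close>.\<close>
  let ?\<sigma> = "map (inv_into W T) ?xs"
  have xs: "set ?xs = T ` W" "distinct ?xs" "sorted_wrt (\<ge>) ?xs"
    using assms(1) by (auto simp: sorted_wrt_rev)
  have "distinct ?\<sigma>"
    using xs by (auto simp: distinct_map intro: inj_on_inv_into)
  moreover have "set ?\<sigma> = W"
    using assms xs by (auto simp: image_comp inv_into_image_cancel)
  moreover have "map T ?\<sigma> = ?xs"
    unfolding map_map by (rule map_idI) (use xs(1) in \<open>auto simp: f_inv_into_f\<close>)
  ultimately show "\<exists>\<sigma>. \<sigma> \<in> permutations_of_set W \<and> sorted_wrt (\<ge>) (map T \<sigma>)"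
    using xs(3) by (metis permutations_of_setI)
next
  fix \<sigma> \<tau>
  assume "\<sigma> \<in> permutations_of_set W \<and> sorted_wrt (\<ge>) (map T \<sigma>)"
    and "\<tau> \<in> permutations_of_set W \<and> sorted_wrt (\<ge>) (map T \<tau>)"
  then have s: "set \<sigma> = W" "distinct \<sigma>" "sorted (rev (map T \<sigma>))"
    and t: "set \<tau> = W" "distinct \<tau>" "sorted (rev (map T \<tau>))"
    by (auto simp: sorted_wrt_rev dest: permutations_of_setD)
  have "rev (map T \<sigma>) = rev (map T \<tau>)"
    using s t assms(2) by (intro sorted_distinct_set_unique) (auto simp: distinct_map)
  then have "map T \<sigma> = map T \<tau>"
    by simp
  then show "\<sigma> = \<tau>"
    using s t assms(2) by (intro map_inj_on[of T \<sigma> \<tau>]) auto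
qed

text \<open>All summands but that of the decreasing ordering vanish. Injectivity keeps a tie from
  letting several orderings contribute.\<close>

lemma exp_energy_eq_sum_permutations:
  assumes "finite_multigraph H" "inj_on T (verts H)"
  shows "ennreal (exp (- (\<Sum>e\<in>edges H. w e * abs_diff T (ends H e)))) =
    (\<Sum>\<sigma>\<in>permutations_of_set (verts H).
      gap_prod (\<lambda>k. \<Sum>e\<in>cut_edges H (set (take (Suc k) \<sigma>)). w e) \<sigma> T)"
proof -
  let ?c = "\<lambda>\<sigma> k. \<Sum>e\<in>cut_edges H (set (take (Suc k) \<sigma>)). w e"
  have fin: "finite (verts H)"
    using assms(1) by (simp add: finite_multigraph_def)
  obtain \<sigma> where \<sigma>: "\<sigma> \<in> permutations_of_set (verts H)" "sorted_wrt (\<ge>) (map T \<sigma>)"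
    and unique: "\<And>\<tau>. \<tau> \<in> permutations_of_set (verts H) \<Longrightarrow> sorted_wrt (\<ge>) (map T \<tau>) \<Longrightarrow> \<tau> = \<sigma>"
    using ex1_decreasing_permutation[OF fin assms(2)] by blast
  have "(\<Sum>\<tau>\<in>permutations_of_set (verts H). gap_prod (?c \<tau>) \<tau> T) =
      (\<Sum>\<tau>\<in>{\<sigma>}. gap_prod (?c \<tau>) \<tau> T)"
    using \<sigma>(1) unique by (intro sum.mono_neutral_right) (auto intro: gap_prod_not_sorted)
  then show ?thesis
    using \<sigma>(2) energy_eq_sum_cuts[OF assms(1) _ _ \<sigma>(2), of w] permutations_of_setD[OF \<sigma>(1)]
    by (simp add: gap_prod_sorted)
qed

section \<open>Energy and cuts of the augmented graph\<close>

lemma finite_multigraph_augment: "finite_multigraph G \<Longrightarrow> finite_multigraph (augment G)"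
  unfolding finite_multigraph_def augment_def
  by (fastforce simp: uprod.set_map)

lemma abs_diff_map_uprod: "abs_diff T (map_uprod f p) = abs_diff (T \<circ> f) p"
  by (cases p) simp

lemma sum_augment_edges:
  assumes "finite_multigraph G"
  shows "(\<Sum>e\<in>edges (augment G). augment_weight x y e * abs_diff (rooted t) (ends (augment G) e)) =
    (\<Sum>v\<in>verts G. x v * \<bar>t v\<bar>) + (\<Sum>e\<in>edges G. y e * abs_diff t (ends G e))"
proof -
  have "rooted t \<circ> Some = t" by auto
  then show ?thesis
    using assms unfolding finite_multigraph_def augment_def
    by (simp, subst sum.union_disjoint)
      (auto simp: sum.reindex augment_weight_def abs_diff_map_uprod)
qed

text \<open>All weights are positive, so one crossing edge suffices. The side without
  \<open>None\<close> is nonempty, and any vertex there is joined to \<open>None\<close> by a new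
  edge.\<close>

lemma cut_energy_pos:
  assumes "finite_multigraph G" "\<And>v. v \<in> verts G \<Longrightarrow> x v > 0" "\<And>e. e \<in> edges G \<Longrightarrow> y e > 0"
    and "A \<noteq> {}" "A \<subset> verts (augment G)"
  shows "cut_energy G x y A > 0"
proof -
  have fin: "finite (cut_edges (augment G) A)"
    using finite_multigraph_augment[OF assms(1)] by (simp add: finite_multigraph_def cut_edges_def)
  have pos: "augment_weight x y e > 0" if "e \<in> cut_edges (augment G) A" for e
    using that assms(2,3) by (auto simp: cut_edges_def augment_def augment_weight_def)
  obtain v where v: "v \<in> verts G" "(None \<in> A) \<noteq> (Some v \<in> A)"
  proof (cases "None \<in> A")
    case True
    then show thesis using assms(5) that by (auto simp: augment_def)
  next
    case False
    then obtain i where "i \<in> A" "i \<noteq> None" using assms(4) by (metis all_not_in_conv)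
    then show thesis using assms(5) False that by (auto simp: augment_def)
  qed
  then have "Inl v \<in> cut_edges (augment G) A"
    by (cases "None \<in> A") (auto simp: cut_edges_def augment_def)
  then show ?thesis
    unfolding cut_energy_def using fin pos by (intro sum_pos) auto
qed

section \<open>Summing the sector integrals\<close>

theorem mainTheorem3:
  fixes G :: "('v, 'e) multigraph" and x :: "'v \<Rightarrow> real" and y :: "'e \<Rightarrow> real" and n :: nat
  assumes "finite_multigraph G" and "connected_multigraph G" and "loopless G"
    and "n = card (verts G)"
    and "\<And>v. v \<in> verts G \<Longrightarrow> x v > 0"
    and "\<And>e. e \<in> edges G \<Longrightarrow> y e > 0"
  shows
    "(LINT t|PiM (verts G) (\<lambda>_. lborel).
        exp (- (\<Sum>v\<in>verts G. x v * \<bar>t v\<bar>) - (\<Sum>e\<in>edges G. y e * abs_diff t (ends G e)))) =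
     (\<Sum>\<sigma>\<in>permutations_of_set (verts (augment G)).
        \<Prod>k=1..n. 1 / cut_energy G x y (set (take k \<sigma>)))"
proof -
  let ?M = "PiM (verts G) (\<lambda>_. lborel :: real measure)"
  let ?H = "augment G"
  let ?f = "\<lambda>t. exp (- (\<Sum>e\<in>edges ?H. augment_weight x y e * abs_diff (rooted t) (ends ?H e)))"
  \<comment> \<open>The index is shifted: gap \<open>k\<close> belongs to the prefix of length
    \<open>k + 1\<close>, so \<open>k < n\<close> covers the lengths 1 to \<open>n\<close>.\<close>
  let ?c = "\<lambda>\<sigma> k. cut_energy G x y (set (take (Suc k) \<sigma>))"
  have finG: "finite (verts G)" and finH: "finite_multigraph ?H"
    using assms(1) finite_multigraph_augment by (auto simp: finite_multigraph_def)
  have verts: "verts ?H = insert None (Some ` verts G)"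
    by (simp add: augment_def)
  have card: "card (verts ?H) = Suc n"
    using finG by (simp add: verts assms(4) card_image)
  have len: "length \<sigma> = Suc n" if "\<sigma> \<in> permutations_of_set (verts ?H)" for \<sigma>
    using that card by (metis distinct_card permutations_of_setD)
  \<comment> \<open>There are \<open>n + 1\<close> augmented vertices, so these prefixes are
    nonempty and proper.\<close>
  have pos: "?c \<sigma> k > 0" if \<sigma>: "\<sigma> \<in> permutations_of_set (verts ?H)" and k: "k < n" for \<sigma> k
  proof (rule cut_energy_pos[OF assms(1,5,6)])
    have "card (set (take (Suc k) \<sigma>)) = Suc k"
      using \<sigma> k len[OF \<sigma>] by (simp add: distinct_card permutations_of_setD)
    then show "set (take (Suc k) \<sigma>) \<noteq> {}" "set (take (Suc k) \<sigma>) \<subset> verts ?H"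
      using \<sigma> k card set_take_subset[of "Suc k" \<sigma>] by (auto dest: permutations_of_setD)
  qed auto
  \<comment> \<open>The pointwise decomposition may fail at ties, hence the equality almost
    everywhere.\<close>
  have "(\<integral>\<^sup>+ t. ennreal (?f t) \<partial>?M) =
      (\<integral>\<^sup>+ t. (\<Sum>\<sigma>\<in>permutations_of_set (verts ?H). gap_prod (?c \<sigma>) \<sigma> (rooted t)) \<partial>?M)"
  proof (rule nn_integral_cong_AE)
    show "AE t in ?M. ennreal (?f t) =
        (\<Sum>\<sigma>\<in>permutations_of_set (verts ?H). gap_prod (?c \<sigma>) \<sigma> (rooted t))"
      using AE_inj_on_rooted[OF finG]
      by eventually_elim (simp add: exp_energy_eq_sum_permutations[OF finH] verts cut_energy_def)
  qed
  also have "\<dots> = (\<Sum>\<sigma>\<in>permutations_of_set (verts ?H). \<integral>\<^sup>+ t. gap_prod (?c \<sigma>) \<sigma> (rooted t) \<partial>?M)"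
    by (intro nn_integral_sum measurable_gap_prod) (auto simp: verts dest: permutations_of_setD)
  also have "\<dots> = (\<Sum>\<sigma>\<in>permutations_of_set (verts ?H). \<Prod>k<n. ennreal (1 / ?c \<sigma> k))"
  proof (intro sum.cong refl)
    fix \<sigma> assume \<sigma>: "\<sigma> \<in> permutations_of_set (verts ?H)"
    then have s: "set \<sigma> = insert None (Some ` verts G)" "distinct \<sigma>"
      by (auto simp: verts dest: permutations_of_setD)
    have "{v. Some v \<in> set \<sigma>} = verts G"
      using s by auto
    then show "(\<integral>\<^sup>+ t. gap_prod (?c \<sigma>) \<sigma> (rooted t) \<partial>?M) = (\<Prod>k<n. ennreal (1 / ?c \<sigma> k))"
      using nn_integral_gap_prod[of \<sigma> "?c \<sigma>"] s len[OF \<sigma>] pos[OF \<sigma>] by simp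
  qed
  also have "\<dots> = ennreal (\<Sum>\<sigma>\<in>permutations_of_set (verts ?H). \<Prod>k<n. 1 / ?c \<sigma> k)"
    using pos by (subst sum_ennreal[symmetric])
      (auto intro!: prod_nonneg sum.cong prod_ennreal simp: less_imp_le)
  finally have nn: "(\<integral>\<^sup>+ t. ennreal (?f t) \<partial>?M) =
      ennreal (\<Sum>\<sigma>\<in>permutations_of_set (verts ?H). \<Prod>k<n. 1 / ?c \<sigma> k)" .
  \<comment> \<open>The Lebesgue integral defaults to 0 on functions that are not integrable, so
    measurability is established before passing from the nonnegative integral.\<close>
  have meas: "?f \<in> borel_measurable ?M"
  proof -
    have "(\<lambda>t. abs_diff (rooted t) (ends ?H e)) \<in> borel_measurable ?M" if e: "e \<in> edges ?H" for e
    proof -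
      obtain i j where ij: "ends ?H e = Upair i j" by (cases "ends ?H e")
      then have "i \<in> verts ?H" "j \<in> verts ?H"
        using finH e by (force simp: finite_multigraph_def)+
      then have [measurable]: "(\<lambda>t. rooted t i) \<in> borel_measurable ?M"
        "(\<lambda>t. rooted t j) \<in> borel_measurable ?M"
        by (auto intro!: measurable_rooted simp: verts)
      show ?thesis unfolding ij abs_diff_Upair by measurable
    qed
    then have "(\<lambda>t. \<Sum>e\<in>edges ?H. augment_weight x y e * abs_diff (rooted t) (ends ?H e))
        \<in> borel_measurable ?M"
      by (intro borel_measurable_sum borel_measurable_times) auto
    then show ?thesis by measurable
  qed
  have "(LINT t|?M. exp (- (\<Sum>v\<in>verts G. x v * \<bar>t v\<bar>) -
      (\<Sum>e\<in>edges G. y e * abs_diff t (ends G e)))) = (LINT t|?M. ?f t)"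
    by (simp add: sum_augment_edges[OF assms(1)])
  also have "\<dots> = (\<Sum>\<sigma>\<in>permutations_of_set (verts ?H). \<Prod>k<n. 1 / ?c \<sigma> k)"
  proof -
    \<comment> \<open>Nonnegativity lets the sum survive the passage into \<open>ennreal\<close> and
      back unchanged.\<close>
    have "0 \<le> (\<Sum>\<sigma>\<in>permutations_of_set (verts ?H). \<Prod>k<n. 1 / ?c \<sigma> k)"
      using pos by (intro sum_nonneg prod_nonneg) (auto simp: less_imp_le)
    then show ?thesis
      using meas by (subst integral_eq_nn_integral) (auto simp: nn)
  qed
  also have "\<dots> = (\<Sum>\<sigma>\<in>permutations_of_set (verts ?H).
      \<Prod>k=1..n. 1 / cut_energy G x y (set (take k \<sigma>)))"
    by (intro sum.cong refl prod.reindex_bij_witness[of _ "\<lambda>k. k - 1" Suc]) auto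
  finally show ?thesis .
qed

end
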